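(* Let $n\ge 1$ and let $M,J,K,D\in\mathbb{R}^{n\times n}$ be constant matrices with $M,J,K,D$ symmetric positive definite, and let $V:\mathbb{R}^n\to\mathbb{R}$ be a differentiable potential. Consider the system with state $(q,\theta,p,s)\in(\mathbb{R}^n)^4$ and inputs $\tau_e,\tau\in\mathbb{R}^n$, $$\dot q=M^{-1}p,\qquad \dot\theta=J^{-1}s,$$ $$\dot p=-\nabla_qV(q)+K(\theta-q)+D(J^{-1}s-M^{-1}p)+\tau_e,$$ $$\dot s=-K(\theta-q)-D(J^{-1}s-M^{-1}p)+\tau .$$ Let $J_e,K_e\in\mathbb{R}^{n\times n}$ be any constant symmetric positive definite matrices such that $D_e:=DK^{-1}K_e$ is symmetric and positive definite. Define the constant matrices $$K_F=-JK^{-1}(K_e-K)M^{-1},\qquad K_G=JK^{-1}K_eJ_e^{-1}-K_F-I_n,\qquad K_H=JK^{-1}K_eJ_e^{-1},$$ and close the loop with the control law $$\tau=K_F\,\tau_e-K_G\,\tau_a-K_F\nabla_qV(q)+K_H\,\tau_u,\qquad \tau_a=K(\theta-q)+D(\dot\theta-\dot q),$$ where $\tau_u\in\mathbb{R}^n$ is a new external input. Then: (i) In the coordinates $(q,\varphi,p,z)$ obtained from $(q,\theta,p,s)$ by the transformation $$\varphi=K_e^{-1}(K_e-K)q+K_e^{-1}K\theta,\qquad z=J_eK_e^{-1}(K_e-K)M^{-1}p+J_eK_e^{-1}KJ^{-1}s,$$ the closed-loop dynamics takes the port-Hamiltonian form $$\begin{bmatrix}\dot q\\ \dot\varphi\\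 \dot p\\ \dot z\end{bmatrix}=\begin{bmatrix}0&0&I_n&0\\0&0&0&I_n\\-I_n&0&-D_e&D_e\\0&-I_n&D_e&-D_e\end{bmatrix}\nabla H_{\mathrm{CL}}(q,\varphi,p,z)+\begin{bmatrix}0\\0\\ \tau_e\\ \tau_u\end{bmatrix},$$ with $$H_{\mathrm{CL}}(q,\varphi,p,z)=\tfrac12p^\top M^{-1}p+\tfrac12z^\top J_e^{-1}z+\tfrac12(\varphi-q)^\top K_e(\varphi-q)+V(q).$$ (ii) The closed-loop dynamics is passive with inputs $(\tau_e,\tau_u)$, outputs $(\dot q,\dot\varphi)$ and storage function $H_{\mathrm{CL}}$.
   Context: All zero blocks are $n\times n$ (or $n\times 1$ in the input vector), and $\nabla H_{\mathrm{CL}}=(\nabla_qH_{\mathrm{CL}},\nabla_\varphi H_{\mathrm{CL}},\nabla_pH_{\mathrm{CL}},\nabla_zH_{\mathrm{CL}})$ is the column of partial gradients. The system models a flexible-joint robot with link positions $q$, motor positions $\theta$, momenta $p=M\dot q$, $s=J\dot\theta$, constant mass matrix $M$, motor inertia $J$, joint stiffness $K$, joint damping $D$, gravity potential $V$, environmental force $\tau_e$ and actuator force $\tau$; equivalently $M\ddot q-K(\theta-q)-D(\dot\theta-\dot q)+\nabla_qV(q)=\tau_e$ and $J\ddot\theta+K(\theta-q)+D(\dot\theta-\dot q)=\tau$. A system with state $x$ is called passive with inputs $(\tau_e,\tau_u)$, outputs $(\dot q,\dot\varphi)$ and storage function $H$ if, along every solution and for all input signals, $\frac{d}{dt}H(x(t))\le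 \dot q^\top\tau_e+\dot\varphi^\top\tau_u$. *)

theory Defs
  imports "HOL-Analysis.Analysis"
begin

definition spd :: "real^'n^'n \<Rightarrow> bool" where
  "spd A \<longleftrightarrow> transpose A = A \<and> (\<forall>x. x \<noteq> 0 \<longrightarrow> 0 < x \<bullet> (A *v x))"

(* Meaningful at points of differentiability; elsewhere it is an arbitrary vector. *)
definition grad :: "('a::real_inner \<Rightarrow> real) \<Rightarrow> 'a \<Rightarrow> 'a" where
  "grad f x = (THE g. GDERIV f x :> g)"

lemma grad_eqI:
  assumes "GDERIV f x :> g"
  shows "grad f x = g"
  unfolding grad_def
proof (rule the_equality)
  show "GDERIV f x :> g" by (fact assms)
next
  fix h assume "GDERIV f x :> h"
  with assms have "(\<lambda>y. y \<bullet> h) = (\<lambda>y. y \<bullet> g)"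
    unfolding gderiv_def by (rule has_derivative_unique[rotated])
  then have "(h - g) \<bullet> h = (h - g) \<bullet> g" by metis
  then have "(h - g) \<bullet> (h - g) = 0" by (simp add: inner_diff_right)
  then show "h = g" by simp
qed

type_synonym 'n state = "(real^'n) \<times> (real^'n) \<times> (real^'n) \<times> (real^'n)"
type_synonym 'n blockrow = "(real^'n^'n) \<times> (real^'n^'n) \<times> (real^'n^'n) \<times> (real^'n^'n)"
type_synonym 'n blockmat = "'n blockrow \<times> 'n blockrow \<times> 'n blockrow \<times> 'n blockrow"

definition block_row_mult :: "('n::finite) blockrow \<Rightarrow> 'n state \<Rightarrow> real^'n" where
  "block_row_mult = (\<lambda>(A1, A2, A3, A4) (v1, v2, v3, v4).
     A1 *v v1 + A2 *v v2 + A3 *v v3 + A4 *v v4)"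

definition block_mult :: "('n::finite) blockmat \<Rightarrow> 'n state \<Rightarrow> 'n state" where
  "block_mult = (\<lambda>(R1, R2, R3, R4) v.
     (block_row_mult R1 v, block_row_mult R2 v, block_row_mult R3 v, block_row_mult R4 v))"

definition grad4 :: "(('n::finite) state \<Rightarrow> real) \<Rightarrow> 'n state \<Rightarrow> 'n state" where
  "grad4 H = (\<lambda>(q, \<phi>, p, z).
     (grad (\<lambda>q'. H (q', \<phi>, p, z)) q,
      grad (\<lambda>\<phi>'. H (q, \<phi>', p, z)) \<phi>,
      grad (\<lambda>p'. H (q, \<phi>, p', z)) p,
      grad (\<lambda>z'. H (q, \<phi>, p, z')) z))"

(* A classical solution of x' = f (u t) x on a nondegenerate time interval T (open, closed or
   half-open, bounded or not). Derivatives are one-sided at end points belonging to T. *)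
definition solves ::
  "('u \<Rightarrow> 'x \<Rightarrow> 'x) \<Rightarrow> (real \<Rightarrow> 'u) \<Rightarrow> real set \<Rightarrow> (real \<Rightarrow> 'x::real_normed_vector) \<Rightarrow> bool" where
  "solves f u T x \<longleftrightarrow> is_interval T \<and> interior T \<noteq> {} \<and>
     (\<forall>t\<in>T. (x has_vector_derivative f (u t) (x t)) (at t within T))"

(* The outputs are the velocities of the two position maps c1 and c2 along the solution;
   the two derivatives are unique because T is nondegenerate. *)
definition passive_sys ::
  "((real^'n) \<times> (real^'n) \<Rightarrow> 'x \<Rightarrow> 'x) \<Rightarrow> ('x \<Rightarrow> real^'n) \<Rightarrow> ('x \<Rightarrow> real^'n) \<Rightarrow>
   ('x::real_normed_vector \<Rightarrow> real) \<Rightarrow> bool" where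
  "passive_sys f c1 c2 H \<longleftrightarrow>
     (\<forall>\<tau>1 \<tau>2 T x. solves f (\<lambda>t. (\<tau>1 t, \<tau>2 t)) T x \<longrightarrow>
       (\<forall>t\<in>T. \<exists>h v1 v2.
          ((\<lambda>t. H (x t)) has_real_derivative h) (at t within T) \<and>
          ((\<lambda>t. c1 (x t)) has_vector_derivative v1) (at t within T) \<and>
          ((\<lambda>t. c2 (x t)) has_vector_derivative v2) (at t within T) \<and>
          h \<le> v1 \<bullet> \<tau>1 t + v2 \<bullet> \<tau>2 t))"

definition robot ::
  "real^'n^'n \<Rightarrow> real^'n^'n \<Rightarrow> real^'n^'n \<Rightarrow> real^'n^'n \<Rightarrow> (real^'n \<Rightarrow> real) \<Rightarrow>
   (real^'n) \<times> (real^'n) \<Rightarrow> ('n::finite) state \<Rightarrow> 'n state" where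
  "robot M J K D V = (\<lambda>(\<tau>\<^sub>e, \<tau>) (q, \<theta>, p, s).
     (matrix_inv M *v p,
      matrix_inv J *v s,
      - grad V q + K *v (\<theta> - q) + D *v (matrix_inv J *v s - matrix_inv M *v p) + \<tau>\<^sub>e,
      - (K *v (\<theta> - q)) - D *v (matrix_inv J *v s - matrix_inv M *v p) + \<tau>))"

(* The velocities entering the joint force are those of the first two components of robot. *)
definition joint_force ::
  "real^'n^'n \<Rightarrow> real^'n^'n \<Rightarrow> real^'n^'n \<Rightarrow> real^'n^'n \<Rightarrow> ('n::finite) state \<Rightarrow> real^'n" where
  "joint_force M J K D = (\<lambda>(q, \<theta>, p, s).
     let dq = matrix_inv M *v p; d\<theta> = matrix_inv J *v s
     in K *v (\<theta> - q) + D *v (d\<theta> - dq))"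

definition gain_F :: "real^'n^'n \<Rightarrow> real^'n^'n \<Rightarrow> real^'n^'n \<Rightarrow> real^'n^'n \<Rightarrow> real^'n^'n" where
  "gain_F M J K K\<^sub>e = - (J ** matrix_inv K ** (K\<^sub>e - K) ** matrix_inv M)"

definition gain_H :: "real^'n^'n \<Rightarrow> real^'n^'n \<Rightarrow> real^'n^'n \<Rightarrow> real^'n^'n \<Rightarrow> real^'n^'n" where
  "gain_H J K J\<^sub>e K\<^sub>e = J ** matrix_inv K ** K\<^sub>e ** matrix_inv J\<^sub>e"

definition gain_G ::
  "real^'n^'n \<Rightarrow> real^'n^'n \<Rightarrow> real^'n^'n \<Rightarrow> real^'n^'n \<Rightarrow> real^'n^'n \<Rightarrow> real^'n^'n" where
  "gain_G M J K J\<^sub>e K\<^sub>e = J ** matrix_inv K ** K\<^sub>e ** matrix_inv J\<^sub>e - gain_F M J K K\<^sub>e - mat 1"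

definition control_law ::
  "real^'n^'n \<Rightarrow> real^'n^'n \<Rightarrow> real^'n^'n \<Rightarrow> real^'n^'n \<Rightarrow> (real^'n \<Rightarrow> real) \<Rightarrow>
   real^'n^'n \<Rightarrow> real^'n^'n \<Rightarrow> (real^'n) \<times> (real^'n) \<Rightarrow> ('n::finite) state \<Rightarrow> real^'n" where
  "control_law M J K D V J\<^sub>e K\<^sub>e = (\<lambda>(\<tau>\<^sub>e, \<tau>\<^sub>u) x.
     gain_F M J K K\<^sub>e *v \<tau>\<^sub>e - gain_G M J K J\<^sub>e K\<^sub>e *v joint_force M J K D x
       - gain_F M J K K\<^sub>e *v grad V (fst x) + gain_H J K J\<^sub>e K\<^sub>e *v \<tau>\<^sub>u)"

definition closed_loop ::
  "real^'n^'n \<Rightarrow> real^'n^'n \<Rightarrow> real^'n^'n \<Rightarrow> real^'n^'n \<Rightarrow> (real^'n \<Rightarrow> real) \<Rightarrow>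
   real^'n^'n \<Rightarrow> real^'n^'n \<Rightarrow> (real^'n) \<times> (real^'n) \<Rightarrow> ('n::finite) state \<Rightarrow> 'n state" where
  "closed_loop M J K D V J\<^sub>e K\<^sub>e = (\<lambda>(\<tau>\<^sub>e, \<tau>\<^sub>u) x.
     robot M J K D V (\<tau>\<^sub>e, control_law M J K D V J\<^sub>e K\<^sub>e (\<tau>\<^sub>e, \<tau>\<^sub>u) x) x)"

definition coord_change ::
  "real^'n^'n \<Rightarrow> real^'n^'n \<Rightarrow> real^'n^'n \<Rightarrow> real^'n^'n \<Rightarrow> real^'n^'n \<Rightarrow>
   ('n::finite) state \<Rightarrow> 'n state" where
  "coord_change M J K J\<^sub>e K\<^sub>e = (\<lambda>(q, \<theta>, p, s).
     (q,
      (matrix_inv K\<^sub>e ** (K\<^sub>e - K)) *v q + (matrix_inv K\<^sub>e ** K) *v \<theta>,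
      p,
      (J\<^sub>e ** matrix_inv K\<^sub>e ** (K\<^sub>e - K) ** matrix_inv M) *v p
        + (J\<^sub>e ** matrix_inv K\<^sub>e ** K ** matrix_inv J) *v s))"

definition H_CL ::
  "real^'n^'n \<Rightarrow> real^'n^'n \<Rightarrow> real^'n^'n \<Rightarrow> (real^'n \<Rightarrow> real) \<Rightarrow> ('n::finite) state \<Rightarrow> real" where
  "H_CL M J\<^sub>e K\<^sub>e V = (\<lambda>(q, \<phi>, p, z).
     1/2 * (p \<bullet> (matrix_inv M *v p)) + 1/2 * (z \<bullet> (matrix_inv J\<^sub>e *v z))
       + 1/2 * ((\<phi> - q) \<bullet> (K\<^sub>e *v (\<phi> - q))) + V q)"

definition port_hamiltonian ::
  "real^'n^'n \<Rightarrow> (('n::finite) state \<Rightarrow> real) \<Rightarrow> (real^'n) \<times> (real^'n) \<Rightarrow> 'n state \<Rightarrow> 'n state" where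
  "port_hamiltonian D\<^sub>e H = (\<lambda>(\<tau>\<^sub>e, \<tau>\<^sub>u) x.
     block_mult
       ((0,       0,       mat 1, 0),
        (0,       0,       0,     mat 1),
        (- mat 1, 0,       - D\<^sub>e,  D\<^sub>e),
        (0,       - mat 1, D\<^sub>e,    - D\<^sub>e)) (grad4 H x)
     + (0, 0, \<tau>\<^sub>e, \<tau>\<^sub>u))"

end

(* In the coordinates (q, phi) the joint force K (theta - q) + D (theta' - q') reads
   Ke (phi - q) + De (phi' - q'), and z = Je phi'. The gains are chosen so that
   K J^-1 K_F = - (Ke - K) M^-1, which cancels the contribution of p' to z', and
   K J^-1 K_H = Ke Je^-1, which leaves z' = tau_u - tau_a.
   In port-Hamiltonian form the skew part of the structure matrix drops out of dH/dt, and
   De contributes - (phi' - q') . De (phi' - q') <= 0. *)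

theory Submission
  imports Defs
begin

section \<open>Symmetric positive definite matrices and their inverses\<close>

lemma spd_transpose: "spd A \<Longrightarrow> transpose A = A"
  by (simp add: spd_def)

lemma spd_invertible:
  assumes "spd A"
  shows "invertible A"
proof -
  have "x = 0" if "A *v x = 0" for x
    using assms that unfolding spd_def by (metis inner_zero_right less_irrefl)
  then show ?thesis
    by (simp add: invertible_left_inverse matrix_left_invertible_ker)
qed

lemma matrix_inv:
  assumes "invertible A"
  shows "A ** matrix_inv A = mat 1" and "matrix_inv A ** A = mat 1"
proof -
  have "A ** matrix_inv A = mat 1 \<and> matrix_inv A ** A = mat 1"
    using assms unfolding invertible_def matrix_inv_def by (rule someI_ex)
  then show "A ** matrix_inv A = mat 1" and "matrix_inv A ** A = mat 1"
    by auto
qed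

lemma matrix_inv_mult_vector:
  fixes A :: "real^'n^'n"
  assumes "invertible A"
  shows "A *v (matrix_inv A *v x) = x" and "matrix_inv A *v (A *v x) = x"
  by (simp_all add: matrix_vector_mul_assoc matrix_inv assms)

text \<open>Transposing \<open>A ** matrix_inv A = mat 1\<close> makes the transposed inverse a left
  inverse of \<open>A\<close>. Symmetry of the inverse is what the gradients of the quadratic terms
  in \<open>p\<close> and \<open>z\<close> require.\<close>

lemma transpose_matrix_inv_spd:
  fixes A :: "real^'n^'n"
  assumes "spd A"
  shows "transpose (matrix_inv A) = matrix_inv A"
proof -
  note inv = matrix_inv[OF spd_invertible[OF assms]]
  have "transpose (matrix_inv A) ** A = transpose (A ** matrix_inv A)"
    by (simp add: matrix_transpose_mul spd_transpose[OF assms])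
  then have left: "transpose (matrix_inv A) ** A = mat 1"
    by (simp add: inv transpose_mat)
  have "transpose (matrix_inv A) = transpose (matrix_inv A) ** (A ** matrix_inv A)"
    by (simp add: inv)
  also have "\<dots> = matrix_inv A"
    by (simp add: matrix_mul_assoc left)
  finally show ?thesis .
qed

lemma inner_symmetric_matrix:
  fixes A :: "real^'n^'n"
  assumes "transpose A = A"
  shows "x \<bullet> (A *v y) = y \<bullet> (A *v x)"
  by (metis assms dot_lmul_matrix inner_commute transpose_matrix_vector)

section \<open>Gradients and the closed-loop energy\<close>

lemma GDERIV_grad:
  fixes f :: "'a::euclidean_space \<Rightarrow> real"
  assumes "f differentiable (at x)"
  shows "GDERIV f x :> grad f x"
proof -
  obtain f' where f': "(f has_derivative f') (at x)"
    using assms by (auto simp: differentiable_def)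
  \<comment> \<open>Riesz representation: \<open>f' h = f' h * 1\<close>, and the adjoint moves
    \<open>f'\<close> onto the factor 1.\<close>
  then have "f' = (\<lambda>h. h \<bullet> adjoint f' 1)"
    by (simp add: adjoint_works has_derivative_linear)
  with f' have "GDERIV f x :> adjoint f' 1"
    by (simp add: gderiv_def)
  then show ?thesis
    by (simp add: grad_eqI)
qed

text \<open>Chain rule for gradients: \<open>e\<close> is the adjoint of \<open>f'\<close> applied
  to \<open>g\<close>.\<close>

lemma GDERIV_compose_has_derivative:
  assumes "(f has_derivative f') (at y)" and "GDERIV H x :> g"
    and "f y = x" and "\<And>h. f' h \<bullet> g = h \<bullet> e"
  shows "GDERIV (\<lambda>y. H (f y)) y :> e"
  using has_derivative_compose[OF assms(1), of H "\<lambda>h. h \<bullet> g"] assms(2-4)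
  by (simp add: gderiv_def)

text \<open>Each partial gradient arises by composing \<open>H\<close> with the affine embedding of
  one slot; the adjoint of that embedding's derivative selects one component of the total
  gradient.\<close>

lemma grad4_eqI:
  assumes "GDERIV H (q, \<phi>, p, z) :> (a, b, c, d)"
  shows "grad4 H (q, \<phi>, p, z) = (a, b, c, d)"
proof -
  note chain = GDERIV_compose_has_derivative[OF _ assms]
  have "GDERIV (\<lambda>q'. H (q', \<phi>, p, z)) q :> a"
    by (rule chain[where f' = "\<lambda>h. (h, 0, 0, 0)"])
      (auto intro!: derivative_eq_intros simp: zero_prod_def)
  moreover have "GDERIV (\<lambda>\<phi>'. H (q, \<phi>', p, z)) \<phi> :> b"
    by (rule chain[where f' = "\<lambda>h. (0, h, 0, 0)"])
      (auto intro!: derivative_eq_intros simp: zero_prod_def)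
  moreover have "GDERIV (\<lambda>p'. H (q, \<phi>, p', z)) p :> c"
    by (rule chain[where f' = "\<lambda>h. (0, 0, h, 0)"])
      (auto intro!: derivative_eq_intros simp: zero_prod_def)
  moreover have "GDERIV (\<lambda>z'. H (q, \<phi>, p, z')) z :> d"
    by (rule chain[where f' = "\<lambda>h. (0, 0, 0, h)"])
      (auto intro!: derivative_eq_intros simp: zero_prod_def)
  ultimately show ?thesis
    by (simp add: grad4_def grad_eqI)
qed

text \<open>The total gradient is computed, since existing partial gradients alone would not justify
  the chain rule along a solution.\<close>

lemma GDERIV_H_CL:
  fixes M :: "real^'n::finite^'n"
  assumes "spd M" "spd J\<^sub>e" "spd K\<^sub>e" and V: "V differentiable (at q)"
  shows "GDERIV (H_CL M J\<^sub>e K\<^sub>e V) (q, \<phi>, p, z) :>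
    (grad V q - K\<^sub>e *v (\<phi> - q), K\<^sub>e *v (\<phi> - q), matrix_inv M *v p, matrix_inv J\<^sub>e *v z)"
proof -
  let ?x = "(q, \<phi>, p, z)"
  \<comment> \<open>Covers all three quadratic terms, with \<open>f\<close> selecting
    \<open>p\<close>, \<open>z\<close> or \<phi> - q. Symmetry of \<open>A\<close> merges the two
    terms of the product rule and absorbs the factor 1/2.\<close>
  have quad: "((\<lambda>x. 1/2 * (f x \<bullet> (A *v f x))) has_derivative (\<lambda>h. f h \<bullet> (A *v f ?x))) (at ?x)"
    if "transpose A = A" "bounded_linear f" for A :: "real^'n^'n" and f :: "'n state \<Rightarrow> real^'n"
  proof -
    have "((\<lambda>x. 1/2 * (f x \<bullet> (A *v f x))) has_derivative
        (\<lambda>h. 1/2 * (f ?x \<bullet> (A *v f h) + f h \<bullet> (A *v f ?x)))) (at ?x)"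
      by (intro has_derivative_mult_right has_derivative_inner
          bounded_linear.has_derivative[OF matrix_vector_mul_bounded_linear]
          bounded_linear_imp_has_derivative that)
    also have "(\<lambda>h. 1/2 * (f ?x \<bullet> (A *v f h) + f h \<bullet> (A *v f ?x))) = (\<lambda>h. f h \<bullet> (A *v f ?x))"
      using inner_symmetric_matrix[OF that(1)] by (simp add: fun_eq_iff)
    finally show ?thesis .
  qed
  have V': "((\<lambda>x. V (fst x)) has_derivative (\<lambda>h. fst h \<bullet> grad V q)) (at ?x)"
    using has_derivative_compose[OF bounded_linear_imp_has_derivative[OF bounded_linear_fst],
        of V "\<lambda>h. h \<bullet> grad V q" ?x UNIV] GDERIV_grad[OF V]
    by (simp add: gderiv_def)
  have "((\<lambda>x. 1/2 * (fst (snd (snd x)) \<bullet> (matrix_inv M *v fst (snd (snd x))))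
      + 1/2 * (snd (snd (snd x)) \<bullet> (matrix_inv J\<^sub>e *v snd (snd (snd x))))
      + 1/2 * ((fst (snd x) - fst x) \<bullet> (K\<^sub>e *v (fst (snd x) - fst x))) + V (fst x))
    has_derivative
      (\<lambda>h. fst (snd (snd h)) \<bullet> (matrix_inv M *v fst (snd (snd ?x)))
      + snd (snd (snd h)) \<bullet> (matrix_inv J\<^sub>e *v snd (snd (snd ?x)))
      + (fst (snd h) - fst h) \<bullet> (K\<^sub>e *v (fst (snd ?x) - fst ?x)) + fst h \<bullet> grad V q)) (at ?x)"
    by (intro has_derivative_add quad V' transpose_matrix_inv_spd spd_transpose assms bounded_linear_intros)
  then show ?thesis
    unfolding gderiv_def H_CL_def
    by (simp add: case_prod_unfold inner_prod_def inner_diff_left inner_diff_right algebra_simps)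
qed

lemma grad4_H_CL:
  fixes M :: "real^'n::finite^'n"
  assumes "spd M" "spd J\<^sub>e" "spd K\<^sub>e" "V differentiable (at q)"
  shows "grad4 (H_CL M J\<^sub>e K\<^sub>e V) (q, \<phi>, p, z) =
    (grad V q - K\<^sub>e *v (\<phi> - q), K\<^sub>e *v (\<phi> - q), matrix_inv M *v p, matrix_inv J\<^sub>e *v z)"
  by (rule grad4_eqI, rule GDERIV_H_CL[OF assms])

lemma GDERIV_grad4_H_CL:
  fixes M :: "real^'n::finite^'n"
  assumes "spd M" "spd J\<^sub>e" "spd K\<^sub>e" "\<And>q. V differentiable (at q)"
  shows "GDERIV (H_CL M J\<^sub>e K\<^sub>e V) x :> grad4 (H_CL M J\<^sub>e K\<^sub>e V) x"
  using GDERIV_H_CL[OF assms] grad4_H_CL[OF assms] by (cases x) simp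

section \<open>Passivity of port-Hamiltonian systems\<close>

lemma matrix_vector_mult_uminus:
  fixes A :: "real^'n^'m"
  shows "(- A) *v x = - (A *v x)"
  by (metis diff_0 matrix_vector_mult_0 matrix_vector_mult_diff_rdistrib)

text \<open>Grouping the damping entries shows that they act only on the velocity difference
  \<open>c - d\<close>.\<close>

lemma port_hamiltonian_eq:
  assumes "grad4 H x = (a, b, c, d)"
  shows "port_hamiltonian D\<^sub>e H (\<tau>\<^sub>e, \<tau>\<^sub>u) x =
    (c, d, - a - D\<^sub>e *v (c - d) + \<tau>\<^sub>e, - b + D\<^sub>e *v (c - d) + \<tau>\<^sub>u)"
  by (simp add: port_hamiltonian_def assms block_mult_def block_row_mult_def
      matrix_vector_mult_uminus matrix_vector_mult_diff_distrib)

lemma port_hamiltonian_passive: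
  fixes H :: "'n::finite state \<Rightarrow> real"
  assumes H: "\<And>x. GDERIV H x :> grad4 H x"
    and pos: "\<And>v. 0 \<le> v \<bullet> (D\<^sub>e *v v)"
  shows "passive_sys (port_hamiltonian D\<^sub>e H) (\<lambda>(q, \<phi>, p, z). q) (\<lambda>(q, \<phi>, p, z). \<phi>) H"
  unfolding passive_sys_def
proof (intro allI impI ballI)
  fix \<tau>1 \<tau>2 :: "real \<Rightarrow> real^'n" and T x t
  assume "solves (port_hamiltonian D\<^sub>e H) (\<lambda>t. (\<tau>1 t, \<tau>2 t)) T x" and "t \<in> T"
  obtain a b c d where g: "grad4 H (x t) = (a, b, c, d)"
    by (metis surj_pair)
  let ?v = "(c, d, - a - D\<^sub>e *v (c - d) + \<tau>1 t, - b + D\<^sub>e *v (c - d) + \<tau>2 t)"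
  have "(x has_vector_derivative port_hamiltonian D\<^sub>e H (\<tau>1 t, \<tau>2 t) (x t)) (at t within T)"
    using \<open>solves _ _ T x\<close> \<open>t \<in> T\<close> by (simp add: solves_def)
  then have x: "(x has_vector_derivative ?v) (at t within T)"
    unfolding port_hamiltonian_eq[OF g] .
  have "((\<lambda>t. H (x t)) has_derivative (\<lambda>s. (s *\<^sub>R ?v) \<bullet> (a, b, c, d))) (at t within T)"
    by (rule has_derivative_compose[OF x[unfolded has_vector_derivative_def] H[of "x t", unfolded gderiv_def g]])
  then have "((\<lambda>t. H (x t)) has_real_derivative ?v \<bullet> (a, b, c, d)) (at t within T)"
    by (rule has_derivative_imp_has_field_derivative) (simp add: mult.commute inner_scaleR_left del: scaleR_Pair)
  \<comment> \<open>The outputs are the first two components of the vector field, hence the momentum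
    gradients \<open>c\<close> and \<open>d\<close>.\<close>
  moreover have "((\<lambda>t. fst (x t)) has_vector_derivative c) (at t within T)"
    using bounded_linear.has_vector_derivative[OF bounded_linear_fst x] by simp
  moreover have "((\<lambda>t. fst (snd (x t))) has_vector_derivative d) (at t within T)"
    using bounded_linear.has_vector_derivative[OF bounded_linear_fst_comp[OF bounded_linear_snd] x] by simp
  \<comment> \<open>Power balance: the terms in \<open>a\<close> and \<open>b\<close> each occur
    twice with opposite signs, leaving the supplied power minus the dissipation.\<close>
  moreover have "?v \<bullet> (a, b, c, d) = c \<bullet> \<tau>1 t + d \<bullet> \<tau>2 t - (c - d) \<bullet> (D\<^sub>e *v (c - d))"
    by (simp add: inner_prod_def inner_simps inner_commute)
  ultimately show "\<exists>h v1 v2.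
      ((\<lambda>t. H (x t)) has_real_derivative h) (at t within T) \<and>
      ((\<lambda>t. case x t of (q, \<phi>, p, z) \<Rightarrow> q) has_vector_derivative v1) (at t within T) \<and>
      ((\<lambda>t. case x t of (q, \<phi>, p, z) \<Rightarrow> \<phi>) has_vector_derivative v2) (at t within T) \<and>
      h \<le> v1 \<bullet> \<tau>1 t + v2 \<bullet> \<tau>2 t"
    using pos[of "c - d"] by (auto simp: case_prod_unfold intro!: exI)
qed

section \<open>The coordinate change and the transfer of solutions and passivity\<close>

lemma linear_coord_change: "linear (coord_change M J K J\<^sub>e K\<^sub>e)"
  by (rule linearI)
    (auto simp: coord_change_def matrix_vector_right_distrib matrix_vector_mult_scaleR algebra_simps)

text \<open>The map is block triangular: in its kernel \<open>q\<close> and \<open>p\<close> vanish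
  at once, and then \<theta> and \<open>s\<close> are killed by products of invertible matrices.
  Injectivity suffices in finite dimension.\<close>

lemma bij_coord_change:
  fixes M :: "real^'n::finite^'n"
  assumes "invertible J" "invertible K" "invertible J\<^sub>e" "invertible K\<^sub>e"
  shows "bij (coord_change M J K J\<^sub>e K\<^sub>e)"
proof -
  have inj: "v = 0" if "invertible A" "A *v v = 0" for A :: "real^'n^'n" and v
    using that by (metis matrix_inv_mult_vector(2) matrix_vector_mult_0_right)
  have inj': "v = 0" if "invertible A" "matrix_inv A *v v = 0" for A :: "real^'n^'n" and v
    using that by (metis matrix_inv_mult_vector(1) matrix_vector_mult_0_right)
  have "inj (coord_change M J K J\<^sub>e K\<^sub>e)"
    unfolding linear_injective_0[OF linear_coord_change]
    by (auto simp: coord_change_def zero_prod_def simp flip: matrix_vector_mul_assoc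
        dest!: inj[OF assms(1)] inj[OF assms(2)] inj[OF assms(3)] inj[OF assms(4)]
         inj'[OF assms(1)] inj'[OF assms(2)] inj'[OF assms(3)] inj'[OF assms(4)])
  then show ?thesis
    by (simp add: bij_def linear_injective_imp_surjective linear_coord_change)
qed

text \<open>A linear map is its own derivative, so conjugacy of the vector fields means applying the
  coordinate change to the velocity itself.\<close>

lemma coord_change_closed_loop:
  fixes M :: "real^'n::finite^'n"
  assumes "spd M" "spd J" "spd K" "spd J\<^sub>e" "spd K\<^sub>e" "\<And>q. V differentiable (at q)"
  shows "coord_change M J K J\<^sub>e K\<^sub>e (closed_loop M J K D V J\<^sub>e K\<^sub>e (\<tau>\<^sub>e, \<tau>\<^sub>u) x) =
    port_hamiltonian (D ** matrix_inv K ** K\<^sub>e) (H_CL M J\<^sub>e K\<^sub>e V) (\<tau>\<^sub>e, \<tau>\<^sub>u)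
      (coord_change M J K J\<^sub>e K\<^sub>e x)"
proof -
  note inv = assms(1-5)[THEN spd_invertible]
  note distribs = matrix_vector_mult_diff_rdistrib matrix_vector_mult_add_rdistrib
    matrix_vector_mult_uminus matrix_vector_mult_diff_distrib matrix_vector_right_distrib
  note mul = matrix_vector_mul_assoc[symmetric] inv[THEN matrix_inv_mult_vector(1)]
    inv[THEN matrix_inv_mult_vector(2)]
  obtain q \<theta> p s where x: "x = (q, \<theta>, p, s)"
    by (metis surj_pair)
  define g where "g = grad V q"
  define dq where "dq = matrix_inv M *v p"
  define d\<theta> where "d\<theta> = matrix_inv J *v s"
  define \<tau>\<^sub>a where "\<tau>\<^sub>a = K *v (\<theta> - q) + D *v (d\<theta> - dq)"
  define d\<phi> where "d\<phi> = matrix_inv K\<^sub>e *v ((K\<^sub>e - K) *v dq) + matrix_inv K\<^sub>e *v (K *v d\<theta>)"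
  define \<phi> where "\<phi> = matrix_inv K\<^sub>e *v ((K\<^sub>e - K) *v q) + matrix_inv K\<^sub>e *v (K *v \<theta>)"
  define dp where "dp = \<tau>\<^sub>a - g + \<tau>\<^sub>e"
  \<comment> \<open>This is the controlled s' after substituting \<open>K_G = K_H - K_F - I\<close>:
    the joint force terms regroup so that \<open>K_F\<close> multiplies exactly p'.\<close>
  define ds where "ds = gain_F M J K K\<^sub>e *v dp + gain_H J K J\<^sub>e K\<^sub>e *v (\<tau>\<^sub>u - \<tau>\<^sub>a)"
  have cl: "closed_loop M J K D V J\<^sub>e K\<^sub>e (\<tau>\<^sub>e, \<tau>\<^sub>u) x = (dq, d\<theta>, dp, ds)"
    by (simp add: x closed_loop_def robot_def control_law_def joint_force_def gain_G_def Let_def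
        dq_def[symmetric] d\<theta>_def[symmetric] g_def[symmetric])
      (simp add: dp_def ds_def \<tau>\<^sub>a_def gain_H_def distribs)
  have \<Phi>: "coord_change M J K J\<^sub>e K\<^sub>e x = (q, \<phi>, p, J\<^sub>e *v d\<phi>)"
    by (simp add: x coord_change_def \<phi>_def d\<phi>_def dq_def d\<theta>_def mul matrix_vector_right_distrib)
  \<comment> \<open>By definition, applying \<open>K\<^sub>e\<close> to \<phi> gives
    \<open>(K\<^sub>e - K) *v q + K *v \<theta>\<close>; subtracting \<open>K\<^sub>e *v q\<close>
    leaves the original spring force.\<close>
  have K\<phi>: "K\<^sub>e *v (\<phi> - q) = K *v (\<theta> - q)"
    by (simp add: \<phi>_def mul distribs)
  \<comment> \<open>The same identity for velocities, multiplied by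
    \<open>D ** matrix_inv K\<close>; this dictates the form of the new damping matrix.\<close>
  have D\<phi>: "(D ** matrix_inv K ** K\<^sub>e) *v (dq - d\<phi>) = D *v (dq - d\<theta>)"
    by (simp add: d\<phi>_def mul distribs)
  \<comment> \<open>The factor in front of \<open>ds\<close> turns \<open>gain_F\<close> into the
    negative of the factor in front of \<open>dp\<close>, and \<open>gain_H\<close> into the
    identity.\<close>
  have dz: "(J\<^sub>e ** matrix_inv K\<^sub>e ** (K\<^sub>e - K) ** matrix_inv M) *v dp
      + (J\<^sub>e ** matrix_inv K\<^sub>e ** K ** matrix_inv J) *v ds = \<tau>\<^sub>u - \<tau>\<^sub>a"
    by (simp add: ds_def gain_F_def gain_H_def matrix_vector_mult_uminus
        matrix_vector_right_distrib matrix_vector_mult_diff_distrib mul)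
  have \<Phi>cl: "coord_change M J K J\<^sub>e K\<^sub>e (dq, d\<theta>, dp, ds) = (dq, d\<phi>, dp, \<tau>\<^sub>u - \<tau>\<^sub>a)"
    by (simp add: coord_change_def dz d\<phi>_def matrix_vector_mul_assoc)
  have "grad4 (H_CL M J\<^sub>e K\<^sub>e V) (q, \<phi>, p, J\<^sub>e *v d\<phi>) = (g - K *v (\<theta> - q), K *v (\<theta> - q), dq, d\<phi>)"
    by (simp add: grad4_H_CL assms K\<phi> g_def dq_def mul)
  note pH = port_hamiltonian_eq[OF this]
  show ?thesis
    unfolding cl \<Phi> \<Phi>cl pH D\<phi>
    by (simp add: dp_def \<tau>\<^sub>a_def matrix_vector_mult_diff_distrib)
qed

text \<open>Bounded linear maps commute with differentiation. The converse direction applies the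
  inverse, again bounded linear, to the transformed trajectory.\<close>

lemma solves_linear_bij_iff:
  fixes \<Phi> :: "'a::euclidean_space \<Rightarrow> 'a"
  assumes "linear \<Phi>" "bij \<Phi>" and conj: "\<And>u x. \<Phi> (f u x) = g u (\<Phi> x)"
  shows "solves f u T x \<longleftrightarrow> solves g u T (\<lambda>t. \<Phi> (x t))"
proof -
  have \<Phi>: "bounded_linear \<Phi>"
    using assms(1) by (rule linear_conv_bounded_linear[THEN iffD1])
  have inv: "bounded_linear (inv \<Phi>)"
    using \<Phi> bij_is_inj[OF assms(2)] by (rule inj_linear_imp_inv_bounded_linear)
  have "(x has_vector_derivative f (u t) (x t)) (at t within T) \<longleftrightarrow>
    ((\<lambda>t. \<Phi> (x t)) has_vector_derivative g (u t) (\<Phi> (x t))) (at t within T)" for t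
    using bounded_linear.has_vector_derivative[OF \<Phi>, of x "f (u t) (x t)" "at t within T"]
      bounded_linear.has_vector_derivative[OF inv, of "\<lambda>t. \<Phi> (x t)" "\<Phi> (f (u t) (x t))" "at t within T"]
      assms(2)
    by (auto simp: conj[symmetric] bij_is_inj)
  then show ?thesis
    by (simp add: solves_def)
qed

text \<open>Storage and outputs are evaluated on the image trajectory, which solves the passive
  system under the same inputs, so the same derivatives serve as witnesses.\<close>

lemma passive_sys_transfer:
  assumes "passive_sys g c1 c2 H"
    and "\<And>u T x. solves f u T x \<Longrightarrow> solves g u T (\<lambda>t. \<Phi> (x t))"
  shows "passive_sys f (\<lambda>x. c1 (\<Phi> x)) (\<lambda>x. c2 (\<Phi> x)) (\<lambda>x. H (\<Phi> x))"
  unfolding passive_sys_def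
  by (intro allI impI ballI, rule assms(1)[unfolded passive_sys_def, rule_format, OF assms(2)])

text \<open>Part (i) is given both as conjugacy of vector fields and as equivalence of solutions;
  bijectivity makes \<Phi> a genuine change of coordinates, and differentiability of
  \<open>H\<close> gives \<open>grad4\<close> its meaning. Part (ii) is given in the old and in the
  new coordinates.\<close>

theorem proposition1:
  fixes M J K D J\<^sub>e K\<^sub>e D\<^sub>e :: "real^'n^'n" and V :: "real^'n \<Rightarrow> real"
    and \<Phi> :: "'n::finite state \<Rightarrow> 'n state"
    and F_cl F_pH :: "(real^'n) \<times> (real^'n) \<Rightarrow> 'n state \<Rightarrow> 'n state"
    and H :: "'n state \<Rightarrow> real"
  assumes "spd M" and "spd J" and "spd K" and "spd D"
    and "\<And>q. V differentiable (at q)"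
    and "spd J\<^sub>e" and "spd K\<^sub>e"
    and "D\<^sub>e = D ** matrix_inv K ** K\<^sub>e" and "spd D\<^sub>e"
    and \<Phi>: "\<Phi> = coord_change M J K J\<^sub>e K\<^sub>e"
    and H: "H = H_CL M J\<^sub>e K\<^sub>e V"
    and F_cl: "F_cl = closed_loop M J K D V J\<^sub>e K\<^sub>e"
    and F_pH: "F_pH = port_hamiltonian D\<^sub>e H"
  shows
    "(linear \<Phi> \<and> bij \<Phi> \<and>
      (\<forall>x. H differentiable (at x)) \<and>
      (\<forall>\<tau>\<^sub>e \<tau>\<^sub>u x. \<Phi> (F_cl (\<tau>\<^sub>e, \<tau>\<^sub>u) x) = F_pH (\<tau>\<^sub>e, \<tau>\<^sub>u) (\<Phi> x)) \<and>
      (\<forall>\<tau>\<^sub>e \<tau>\<^sub>u T x. solves F_cl (\<lambda>t. (\<tau>\<^sub>e t, \<tau>\<^sub>u t)) T x \<longleftrightarrow>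
                   solves F_pH (\<lambda>t. (\<tau>\<^sub>e t, \<tau>\<^sub>u t)) T (\<lambda>t. \<Phi> (x t)))) \<and>
     (passive_sys F_cl (\<lambda>x. fst (\<Phi> x)) (\<lambda>x. fst (snd (\<Phi> x))) (\<lambda>x. H (\<Phi> x)) \<and>
      passive_sys F_pH (\<lambda>(q, \<phi>, p, z). q) (\<lambda>(q, \<phi>, p, z). \<phi>) H)"
proof -
  have lin: "linear \<Phi>"
    unfolding \<Phi> by (rule linear_coord_change)
  have bij: "bij \<Phi>"
    unfolding \<Phi> by (intro bij_coord_change spd_invertible assms)
  have GH: "GDERIV H x :> grad4 H x" for x
    unfolding H by (rule GDERIV_grad4_H_CL) (fact assms)+
  have conj: "\<Phi> (F_cl u x) = F_pH u (\<Phi> x)" for u x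
    using coord_change_closed_loop[OF assms(1-3,6,7,5)]
    by (cases u) (simp add: \<Phi> F_cl F_pH H assms(8))
  have sol: "solves F_cl u T x \<longleftrightarrow> solves F_pH u T (\<lambda>t. \<Phi> (x t))" for u T x
    by (rule solves_linear_bij_iff[where f = F_cl and g = F_pH]) (fact lin bij conj)+
  have "0 \<le> v \<bullet> (D\<^sub>e *v v)" for v
    using \<open>spd D\<^sub>e\<close> by (cases "v = 0") (auto simp: spd_def less_imp_le)
  then have pas: "passive_sys F_pH (\<lambda>(q, \<phi>, p, z). q) (\<lambda>(q, \<phi>, p, z). \<phi>) H"
    unfolding F_pH by (intro port_hamiltonian_passive GH)
  have "passive_sys F_cl (\<lambda>x. fst (\<Phi> x)) (\<lambda>x. fst (snd (\<Phi> x))) (\<lambda>x. H (\<Phi> x))"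
    using passive_sys_transfer[OF pas sol[THEN iffD1]] by (simp add: case_prod_unfold)
  then show ?thesis
    using lin bij conj sol pas GH[unfolded gderiv_def, THEN differentiableI] by simp
qed

end
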